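(* Fiber products of bundles are associative. More precisely, given bundles of probability schemes $\Omega_1\to\Gamma_0\leftarrow\Omega_2\to\Gamma_1\leftarrow\Omega_3$, the rebracketing map $$\Omega_1\otimes_{\Gamma_0}(\Omega_2\otimes_{\Gamma_1}\Omega_3)\longrightarrow(\Omega_1\otimes_{\Gamma_0}\Omega_2)\otimes_{\Gamma_1}\Omega_3,\qquad\langle\omega_1,\langle\omega_2,\omega_3\rangle\rangle\longmapsto\langle\langle\omega_1,\omega_2\rangle,\omega_3\rangle,$$ is an isomorphism of schemes.
   Context: A (probability) scheme is a finite set $\Omega$ with a function $\mathrm{pr}\colon\Omega\to(0,\infty)$ such that $\sum_{\omega}\mathrm{pr}(\omega)=1$. A bundle is a map $\pi\colon\Omega\to\Omega'$ of schemes with $\mathrm{pr}'(\omega')=\sum_{\omega\in\pi^{-1}(\omega')}\mathrm{pr}(\omega)$ for all $\omega'\in\Omega'$ (hence surjective). An isomorphism of schemes is a bijection of underlying sets preserving point probabilities. For bundles $\pi_1\colon(\Omega_1,\mathrm{pr}_1)\to(\Omega_0,\mathrm{pr}_0)$ and $\pi_2\colon(\Omega_2,\mathrm{pr}_2)\to(\Omega_0,\mathrm{pr}_0)$, the fiber product $\Omega_1\otimes_{\Omega_0}\Omega_2$ is the scheme on $\{\langle\omega_1,\omega_2\rangle:\pi_1(\omega_1)=\pi_2(\omega_2)\}$ with distribution $\langle\omega_1,\omega_2\rangle\mapsto\mathrm{pr}_1(\omega_1)\mathrm{pr}_2(\omega_2)/\mathrm{pr}_0(\pi_1(\omega_1))$;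 its coordinate projections are bundles. The bundle $\Omega_2\otimes_{\Gamma_1}\Omega_3\to\Gamma_0$ is the coordinate projection to $\Omega_2$ followed by $\Omega_2\to\Gamma_0$, and $\Omega_1\otimes_{\Gamma_0}\Omega_2\to\Gamma_1$ is the coordinate projection to $\Omega_2$ followed by $\Omega_2\to\Gamma_1$. *)

theory Defs
  imports Complex_Main "HOL-Library.FuncSet"
begin

(* Points and probabilities are bundled in a record; the values of pr off the
   carrier are irrelevant, so everything below is relativised to the carrier. *)
record 'a prob_scheme =
  points :: "'a set"
  pr :: "'a \<Rightarrow> real"

definition is_scheme :: "'a prob_scheme \<Rightarrow> bool" where
  "is_scheme S \<longleftrightarrow>
     finite (points S) \<and> (\<forall>x \<in> points S. 0 < pr S x) \<and> (\<Sum>x \<in> points S. pr S x) = 1"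

definition is_bundle :: "'a prob_scheme \<Rightarrow> 'b prob_scheme \<Rightarrow> ('a \<Rightarrow> 'b) \<Rightarrow> bool" where
  "is_bundle S T f \<longleftrightarrow>
     is_scheme S \<and> is_scheme T \<and> f \<in> points S \<rightarrow> points T \<and>
     (\<forall>y \<in> points T. pr T y = (\<Sum>x \<in> {x \<in> points S. f x = y}. pr S x))"

definition is_scheme_iso :: "'a prob_scheme \<Rightarrow> 'b prob_scheme \<Rightarrow> ('a \<Rightarrow> 'b) \<Rightarrow> bool" where
  "is_scheme_iso S T f \<longleftrightarrow>
     is_scheme S \<and> is_scheme T \<and> bij_betw f (points S) (points T) \<and>
     (\<forall>x \<in> points S. pr T (f x) = pr S x)"

(* fiber_product S1 f1 S0 f2 S2 is the fiber product of the cospan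
   f1 : S1 \<rightarrow> S0 \<leftarrow> S2 : f2; meaningful when f1 and f2 are bundles. *)
definition fiber_product ::
  "'a prob_scheme \<Rightarrow> ('a \<Rightarrow> 'c) \<Rightarrow> 'c prob_scheme \<Rightarrow> ('b \<Rightarrow> 'c) \<Rightarrow> 'b prob_scheme
     \<Rightarrow> ('a \<times> 'b) prob_scheme" where
  "fiber_product S1 f1 S0 f2 S2 =
     \<lparr>points = {(x, y). x \<in> points S1 \<and> y \<in> points S2 \<and> f1 x = f2 y},
      pr = (\<lambda>(x, y). pr S1 x * pr S2 y / pr S0 (f1 x))\<rparr>"

lemma is_bundle_comp:
  assumes f: "is_bundle S T f" and g: "is_bundle T U g"
  shows "is_bundle S U (g \<circ> f)"
proof -
  have "pr U z = (\<Sum>x \<in> {x \<in> points S. (g \<circ> f) x = z}. pr S x)" if z: "z \<in> points U" for z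
  proof -
    have "pr U z = (\<Sum>y \<in> {y \<in> points T. g y = z}. \<Sum>x \<in> {x \<in> points S. f x = y}. pr S x)"
      using f g z by (simp add: is_bundle_def)
    also have "\<dots> = (\<Sum>y \<in> {y \<in> points T. g y = z}.
        \<Sum>x \<in> {x \<in> {x \<in> points S. (g \<circ> f) x = z}. f x = y}. pr S x)"
      by (intro sum.cong refl) auto
    also have "\<dots> = (\<Sum>x \<in> {x \<in> points S. (g \<circ> f) x = z}. pr S x)"
      using f g by (intro sum.group) (auto simp: is_bundle_def is_scheme_def)
    finally show ?thesis .
  qed
  then show ?thesis using f g by (auto simp: is_bundle_def)
qed

lemma is_schemeI_marginal:
  assumes "finite (points S)" "\<And>x. x \<in> points S \<Longrightarrow> 0 < pr S x"
    and T: "is_scheme T" and f: "f \<in> points S \<rightarrow> points T"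
    and m: "\<And>y. y \<in> points T \<Longrightarrow> pr T y = (\<Sum>x \<in> {x \<in> points S. f x = y}. pr S x)"
  shows "is_scheme S"
proof -
  have "(\<Sum>x \<in> points S. pr S x) = (\<Sum>y \<in> points T. \<Sum>x \<in> {x \<in> points S. f x = y}. pr S x)"
    using assms by (intro sum.group[symmetric]) (auto simp: is_scheme_def)
  also have "\<dots> = 1" using T m by (simp add: is_scheme_def)
  finally show ?thesis using assms by (simp add: is_scheme_def)
qed

lemma fiber_product_bundles:
  assumes f: "is_bundle S1 S0 f1" and g: "is_bundle S2 S0 f2"
  shows is_scheme_fiber_product: "is_scheme (fiber_product S1 f1 S0 f2 S2)"
    and is_bundle_fst: "is_bundle (fiber_product S1 f1 S0 f2 S2) S1 fst"
    and is_bundle_snd: "is_bundle (fiber_product S1 f1 S0 f2 S2) S2 snd"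
proof -
  let ?P = "fiber_product S1 f1 S0 f2 S2"
  note defs = fiber_product_def is_bundle_def is_scheme_def
  have fin: "finite (points ?P)"
    by (rule finite_subset[of _ "points S1 \<times> points S2"]) (use f g in \<open>auto simp: defs\<close>)
  have pos0: "0 < pr S0 (f1 x)" if "x \<in> points S1" for x
    using f that by (auto simp: is_bundle_def is_scheme_def)
  have pos: "0 < pr ?P p" if "p \<in> points ?P" for p
    using f g that pos0 by (auto simp: defs intro!: divide_pos_pos mult_pos_pos)
  have m1: "pr S1 x = (\<Sum>p \<in> {p \<in> points ?P. fst p = x}. pr ?P p)" if x: "x \<in> points S1" for x
  proof -
    have "{p \<in> points ?P. fst p = x} = Pair x ` {y \<in> points S2. f2 y = f1 x}"
      using x by (auto simp: fiber_product_def)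
    then have "(\<Sum>p \<in> {p \<in> points ?P. fst p = x}. pr ?P p)
        = (\<Sum>y \<in> {y \<in> points S2. f2 y = f1 x}. pr S1 x / pr S0 (f1 x) * pr S2 y)"
      by (simp add: sum.reindex inj_on_def fiber_product_def)
    also have "\<dots> = pr S1 x / pr S0 (f1 x) * pr S0 (f1 x)"
      using f g x by (subst sum_distrib_left[symmetric]) (simp add: is_bundle_def Pi_iff)
    finally show ?thesis using pos0[OF x] by simp
  qed
  have m2: "pr S2 y = (\<Sum>p \<in> {p \<in> points ?P. snd p = y}. pr ?P p)" if y: "y \<in> points S2" for y
  proof -
    have y0: "f2 y \<in> points S0" "0 < pr S0 (f2 y)"
      using g y by (auto simp: is_bundle_def is_scheme_def)
    have "{p \<in> points ?P. snd p = y} = (\<lambda>x. (x, y)) ` {x \<in> points S1. f1 x = f2 y}"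
      using y by (auto simp: fiber_product_def)
    then have "(\<Sum>p \<in> {p \<in> points ?P. snd p = y}. pr ?P p)
        = (\<Sum>x \<in> {x \<in> points S1. f1 x = f2 y}. pr S2 y / pr S0 (f2 y) * pr S1 x)"
      by (auto simp: sum.reindex inj_on_def fiber_product_def intro!: sum.cong)
    also have "\<dots> = pr S2 y / pr S0 (f2 y) * pr S0 (f2 y)"
      using f y0 by (subst sum_distrib_left[symmetric]) (simp add: is_bundle_def)
    finally show ?thesis using y0 by simp
  qed
  have maps: "fst \<in> points ?P \<rightarrow> points S1" "snd \<in> points ?P \<rightarrow> points S2"
    by (auto simp: fiber_product_def)
  show "is_scheme ?P"
    by (rule is_schemeI_marginal[of ?P S1 fst]) (use fin pos m1 maps f in \<open>auto simp: is_bundle_def\<close>)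
  then show "is_bundle ?P S1 fst" "is_bundle ?P S2 snd"
    using f g m1 m2 maps by (simp_all add: is_bundle_def)
qed

end

theory Submission
  imports Defs
begin

text \<open>Both bracketings carve out the same triples, those with \<open>f1 x = f2 y\<close> and
  \<open>g2 y = g3 z\<close>, and weigh each by the product of its three probabilities divided by
  \<open>pr \<Gamma>0 (f1 x) * pr \<Gamma>1 (g2 y)\<close>; this expression ignores the bracketing.
  That both sides are schemes comes from \<open>is_scheme_fiber_product\<close>.\<close>

theorem corollary8:
  fixes \<Omega>1 :: "'a prob_scheme" and \<Omega>2 :: "'b prob_scheme" and \<Omega>3 :: "'c prob_scheme"
    and \<Gamma>0 :: "'d prob_scheme" and \<Gamma>1 :: "'e prob_scheme"
    and f1 :: "'a \<Rightarrow> 'd" and f2 :: "'b \<Rightarrow> 'd" and g2 :: "'b \<Rightarrow> 'e" and g3 :: "'c \<Rightarrow> 'e"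
  assumes "is_bundle \<Omega>1 \<Gamma>0 f1" and "is_bundle \<Omega>2 \<Gamma>0 f2"
    and "is_bundle \<Omega>2 \<Gamma>1 g2" and "is_bundle \<Omega>3 \<Gamma>1 g3"
  shows "is_scheme_iso
           (fiber_product \<Omega>1 f1 \<Gamma>0 (f2 \<circ> fst) (fiber_product \<Omega>2 g2 \<Gamma>1 g3 \<Omega>3))
           (fiber_product (fiber_product \<Omega>1 f1 \<Gamma>0 f2 \<Omega>2) (g2 \<circ> snd) \<Gamma>1 g3 \<Omega>3)
           (\<lambda>(x, (y, z)). ((x, y), z))"
proof -
  let ?L = "fiber_product \<Omega>1 f1 \<Gamma>0 (f2 \<circ> fst) (fiber_product \<Omega>2 g2 \<Gamma>1 g3 \<Omega>3)"
  let ?R = "fiber_product (fiber_product \<Omega>1 f1 \<Gamma>0 f2 \<Omega>2) (g2 \<circ> snd) \<Gamma>1 g3 \<Omega>3"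
  let ?h = "\<lambda>(x, (y, z)). ((x, y), z)"
  \<comment> \<open>The outer product needs a bundle to \<open>\<Gamma>0\<close>: the projection to
    \<open>\<Omega>2\<close> is a bundle, and composing it with \<open>f2\<close> gives
    another.\<close>
  have "is_scheme ?L"
    using assms by (intro is_scheme_fiber_product is_bundle_comp[OF is_bundle_fst])
  moreover have "is_scheme ?R"
    using assms by (intro is_scheme_fiber_product is_bundle_comp[OF is_bundle_snd])
  moreover have "bij_betw ?h (points ?L) (points ?R)"
    by (rule bij_betw_byWitness[where f' = "\<lambda>((x, y), z). (x, (y, z))"])
      (auto simp: fiber_product_def)
  \<comment> \<open>The outer denominator on one side is the inner one on the other, since
    \<open>(g2 \<circ> snd) (x, y) = g2 y\<close>; only the order of factors differs.\<close>
  moreover have "\<forall>p \<in> points ?L. pr ?R (?h p) = pr ?L p"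
    by (auto simp: fiber_product_def mult_ac)
  ultimately show ?thesis
    by (simp add: is_scheme_iso_def)
qed

end
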